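(* Let $F_G=0.0796$, let $x_c=\Phi^{-1}(1-F_G)$, and for real $\varepsilon_3$ near $0$ let $$F_{\rm C}(\varepsilon_3)=\int_{x_c}^{\infty}\phi(\nu)\left[1+\frac{\varepsilon_3}{6}H_3(\nu)\right]d\nu,\qquad F_{\rm V}(\varepsilon_3)=\int_{-\infty}^{-x_c}\phi(\nu)\left[1+\frac{\varepsilon_3}{6}H_3(\nu)\right]d\nu .$$ Let $h(p)=-p\log_2 p$ and $A=\frac{(x_c^2-1)\,\phi(x_c)}{6}$. Then the cluster-void Shannon entropy difference $\Delta H_{\rm CV}(\varepsilon_3)=h(F_{\rm C}(\varepsilon_3))-h(F_{\rm V}(\varepsilon_3))$ satisfies, to first order as $\varepsilon_3\to0$, $$\Delta H_{\rm CV}(\varepsilon_3)=2A\,h'(F_G)\,\varepsilon_3+O(\varepsilon_3^2),\qquad h'(F_G)=-\log_2(e\,F_G)>0,$$ where $2A\,h'(F_G)=0.107$ (bits) to three decimal places.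
   Context: $\phi(\nu)=e^{-\nu^2/2}/\sqrt{2\pi}$ is the standard normal density, $\Phi$ the standard normal cumulative distribution function, and $H_3(x)=x^3-3x$ the third (probabilists') Hermite polynomial. $F_{\rm C}$ and $F_{\rm V}$ are the cluster and void fractions in the first-order Edgeworth model for the normalized density contrast $\nu$, with threshold $x_c$ calibrated so that both equal the Gaussian value $F_G=7.96\%$ at $\varepsilon_3=0$; $\varepsilon_3$ is the dimensionless third-cumulant amplitude. *)

theory Defs
  imports "HOL-Probability.Probability" "HOL-Library.Landau_Symbols"
begin

definition Phi :: "real \<Rightarrow> real" where
  "Phi x = cdf std_normal_distribution x"

definition H3 :: "real \<Rightarrow> real" where
  "H3 x = x ^ 3 - 3 * x"

definition F_G :: real where
  "F_G = 0.0796"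

text \<open>
  \<open>Phi\<close> is injective with range \<open>{0<..<1}\<close>, so \<open>inv Phi\<close> is the genuine inverse at the
  point \<open>1 - F_G\<close>.
\<close>

definition x_c :: real where
  "x_c = inv Phi (1 - F_G)"

definition edgeworth_density :: "real \<Rightarrow> real \<Rightarrow> real" where
  "edgeworth_density \<epsilon> \<nu> = std_normal_density \<nu> * (1 + \<epsilon> / 6 * H3 \<nu>)"

definition F_C :: "real \<Rightarrow> real" where
  "F_C \<epsilon> = (LBINT \<nu>:{x_c..}. edgeworth_density \<epsilon> \<nu>)"

definition F_V :: "real \<Rightarrow> real" where
  "F_V \<epsilon> = (LBINT \<nu>:{..- x_c}. edgeworth_density \<epsilon> \<nu>)"

definition h :: "real \<Rightarrow> real" where
  "h p = - p * log 2 p"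

definition A :: real where
  "A = (x_c\<^sup>2 - 1) * std_normal_density x_c / 6"

definition Delta_H_CV :: "real \<Rightarrow> real" where
  "Delta_H_CV \<epsilon> = h (F_C \<epsilon>) - h (F_V \<epsilon>)"

end

(*
  The function (1 - t^2) phi(t) is an antiderivative of phi(t) H_3(t), so the cluster fraction is
  exactly affine, F_C(eps) = F_G + A eps, and the reflection t -> -t gives F_V(eps) = F_C(-eps).
  The expansion is then the first-order Taylor expansion of h at F_G, applied to A eps and - A eps.

  For the numerical value, the Taylor polynomials of exp at 0 alternately bound exp(-t^2/2) from
  below and above; integrating them encloses Phi and hence x_c, because Phi is increasing.  The
  relative sensitivity of (x^2 - 1) phi(x) near x_c is about 1.5 per unit of x, so an interval of
  length 10^-3 around x_c suffices for three decimal places.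
*)
theory Submission
  imports Defs "HOL-Real_Asymp.Real_Asymp"
begin

section \<open>The normal distribution function\<close>

text \<open>Substitution of \<open>- x\<close> for \<open>x\<close>. It gives the value of
  \<open>Phi\<close> at 0 and later carries the void tail onto the cluster tail.\<close>

lemma set_integral_atMost_uminus:
  fixes f :: "real \<Rightarrow> real"
  shows "(LBINT x:{..-a}. f x) = (LBINT x:{a..}. f (- x))"
  unfolding set_lebesgue_integral_def
  by (subst lborel_integral_real_affine[where c = "-1" and t = 0])
     (auto intro!: Bochner_Integration.integral_cong simp: indicator_def)

lemma std_normal_density_uminus [simp]: "std_normal_density (- x) = std_normal_density x"
  by (simp add: std_normal_density_def)

lemma std_normal_density_has_real_derivative:
  "(std_normal_density has_real_derivative - x * std_normal_density x) (at x)"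
proof -
  have "((\<lambda>x. (1 / sqrt (2 * pi)) * exp (- x\<^sup>2 / 2)) has_real_derivative
          (1 / sqrt (2 * pi)) * (exp (- x\<^sup>2 / 2) * - x)) (at x)"
    by (intro DERIV_cmult DERIV_fun_exp) (auto intro!: derivative_eq_intros)
  thus ?thesis
    unfolding std_normal_density_def [abs_def] by (simp add: mult_ac)
qed

lemma continuous_std_normal_density: "isCont std_normal_density x"
  using std_normal_density_has_real_derivative by (rule DERIV_isCont)

lemma integrable_std_normal_density: "integrable lborel std_normal_density"
  using integrable_std_normal_moment[of 0] by simp

lemma set_integrable_std_normal_density:
  "S \<in> sets borel \<Longrightarrow> set_integrable lborel S std_normal_density"
  unfolding set_integrable_def
  using integrable_std_normal_density by (intro integrable_mult_indicator) auto

lemma set_integral_greaterThan_eq_atLeast: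
  fixes f :: "real \<Rightarrow> real"
  shows "(LBINT t:{x<..}. f t) = (LBINT t:{x..}. f t)"
  unfolding set_lebesgue_integral_def
  by (rule integral_discrete_difference[of "{x}"]) (auto simp: indicator_def)

lemma Phi_eq_integral: "Phi x = (LBINT t:{..x}. std_normal_density t)"
proof -
  have "Phi x = enn2real (\<integral>\<^sup>+t. ennreal (std_normal_density t * indicator {..x} t) \<partial>lborel)"
    unfolding Phi_def cdf_def measure_def
    by (subst emeasure_density)
       (auto intro!: arg_cong[of _ _ enn2real] nn_integral_cong simp: indicator_def)
  also have "\<dots> = (LBINT t:{..x}. std_normal_density t)"
    unfolding set_lebesgue_integral_def
    by (subst integral_eq_nn_integral)
       (auto intro!: arg_cong[of _ _ enn2real] nn_integral_cong simp: indicator_def)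
  finally show ?thesis .
qed

lemma integral_std_normal_density_atLeast:
  "(LBINT t:{x..}. std_normal_density t) = 1 - Phi x"
proof -
  have "1 = (LBINT t:UNIV. std_normal_density t)"
    using integral_std_normal_moment_even[of 0] by (simp add: set_lebesgue_integral_def)
  also have "\<dots> = (LBINT t:{..x} \<union> {x<..}. std_normal_density t)"
    by (rule arg_cong[of _ _ "\<lambda>S. set_lebesgue_integral lborel S std_normal_density"]) auto
  also have "\<dots> = Phi x + (LBINT t:{x<..}. std_normal_density t)"
    unfolding Phi_eq_integral
    by (intro set_integral_Un set_integrable_std_normal_density) auto
  also have "(LBINT t:{x<..}. std_normal_density t) = (LBINT t:{x..}. std_normal_density t)"
    by (rule set_integral_greaterThan_eq_atLeast)
  finally show ?thesis by simp
qed

lemma Phi_0: "Phi 0 = 1 / 2"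
  using set_integral_atMost_uminus[of 0 std_normal_density]
    integral_std_normal_density_atLeast[of 0] Phi_eq_integral[of 0] by simp

text \<open>The fundamental theorem of calculus is applied on a compact interval, after splitting
  off the constant tail mass \<open>Phi (x - 1)\<close>. The base point \<open>x - 1\<close> keeps
  \<open>x\<close> in the interior, so the derivative is two-sided.\<close>

lemma Phi_has_real_derivative: "(Phi has_real_derivative std_normal_density x) (at x)"
proof -
  have *: "Phi y = Phi (x - 1) + integral {x - 1..y} std_normal_density" if "y \<ge> x - 1" for y
  proof -
    have "Phi y = (LBINT t:{..x - 1} \<union> {x - 1<..y}. std_normal_density t)"
      unfolding Phi_eq_integral
      by (rule arg_cong[of _ _ "\<lambda>S. set_lebesgue_integral lborel S std_normal_density"])
         (use that in auto)
    also have "\<dots> = Phi (x - 1) + (LBINT t:{x - 1<..y}. std_normal_density t)"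
      unfolding Phi_eq_integral
      by (intro set_integral_Un set_integrable_std_normal_density) auto
    also have "(LBINT t:{x - 1<..y}. std_normal_density t) = (LBINT t:{x - 1..y}. std_normal_density t)"
      unfolding set_lebesgue_integral_def
      by (rule integral_discrete_difference[of "{x - 1}"]) (auto simp: indicator_def)
    also have "\<dots> = integral {x - 1..y} std_normal_density"
      by (intro set_borel_integral_eq_integral set_integrable_std_normal_density) auto
    finally show ?thesis .
  qed
  have "((\<lambda>y. integral {x - 1..y} std_normal_density) has_real_derivative std_normal_density x)
          (at x within {x - 1..x + 1})"
    by (rule integral_has_real_derivative)
       (auto intro!: continuous_at_imp_continuous_on continuous_std_normal_density)
  hence "((\<lambda>y. integral {x - 1..y} std_normal_density) has_real_derivative std_normal_density x) (at x)"
    by (subst (asm) at_within_Icc_at) auto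
  hence "((\<lambda>y. Phi (x - 1) + integral {x - 1..y} std_normal_density)
            has_real_derivative std_normal_density x) (at x)"
    by (auto intro!: derivative_eq_intros)
  moreover have "\<forall>\<^sub>F y in nhds x. Phi y = Phi (x - 1) + integral {x - 1..y} std_normal_density"
    using eventually_nhds_in_open[of "{x - 1<..}" x]
    by (auto elim!: eventually_mono intro: * less_imp_le)
  ultimately show ?thesis
    by (subst DERIV_cong_ev[OF refl _ refl])
qed

lemma Phi_less_iff [simp]: "Phi x < Phi y \<longleftrightarrow> x < y"
proof -
  have "strict_mono Phi"
  proof
    fix x y :: real assume "x < y"
    thus "Phi x < Phi y"
      using Phi_has_real_derivative normal_density_pos[OF zero_less_one]
      by (intro DERIV_pos_imp_increasing[of x y Phi]) blast+
  qed
  thus ?thesis by (rule strict_mono_less)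
qed

text \<open>\<open>inv\<close> only chooses some preimage, so a preimage must first be shown to
  exist; the intermediate value theorem supplies it. Strict monotonicity of \<open>Phi\<close> then
  turns bounds on values into bounds on the argument.\<close>

lemma inv_Phi_bounds:
  assumes "Phi a < p" "p < Phi b"
  shows "Phi (inv Phi p) = p" "a < inv Phi p" "inv Phi p < b"
proof -
  have "a < b" using assms by (metis Phi_less_iff less_trans)
  have "isCont Phi x" for x
    using Phi_has_real_derivative by (rule DERIV_isCont)
  then obtain x where "Phi x = p"
    using IVT[of Phi a p b] assms \<open>a < b\<close> by auto
  thus *: "Phi (inv Phi p) = p"
    by (metis f_inv_into_f rangeI)
  show "a < inv Phi p" "inv Phi p < b"
    using assms Phi_less_iff * by metis+
qed

section \<open>Enclosures by alternating Taylor polynomials\<close>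

definition exp_taylor :: "nat \<Rightarrow> real \<Rightarrow> real" where
  "exp_taylor n x = (\<Sum>k<n. x ^ k / fact k)"

text \<open>The Lagrange remainder is a positive multiple of \<open>x ^ n\<close>, whose sign for
  nonpositive \<open>x\<close> is decided by the parity of \<open>n\<close>. Here \<open>n\<close>
  counts terms, so the degree is \<open>n - 1\<close>.\<close>

lemma exp_taylor_bounds:
  assumes "x \<le> 0"
  shows "even n \<Longrightarrow> exp_taylor n x \<le> exp x" "odd n \<Longrightarrow> exp x \<le> exp_taylor n x"
proof -
  obtain t where t: "exp x = exp_taylor n x + exp t / fact n * x ^ n"
    using Maclaurin_exp_le[of x n] by (auto simp: exp_taylor_def)
  show "exp_taylor n x \<le> exp x" if "even n"
    unfolding t using that by (simp add: zero_le_even_power)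
  show "exp x \<le> exp_taylor n x" if "odd n"
  proof -
    have "exp t / fact n * x ^ n \<le> 0"
      using that assms by (intro mult_nonneg_nonpos) (auto simp: power_le_zero_eq odd_pos)
    thus ?thesis unfolding t by simp
  qed
qed

text \<open>Termwise antiderivative of \<open>exp_taylor n (- x\<^sup>2 / 2)\<close> vanishing at 0;
  it approximates \<open>sqrt (2 * pi) * (Phi x - 1 / 2)\<close>.\<close>

definition gauss_taylor :: "nat \<Rightarrow> real \<Rightarrow> real" where
  "gauss_taylor n x = (\<Sum>k<n. (-1) ^ k * x ^ (2 * k + 1) / (2 ^ k * fact k * real (2 * k + 1)))"

lemma gauss_taylor_has_real_derivative:
  "(gauss_taylor n has_real_derivative exp_taylor n (- x\<^sup>2 / 2)) (at x)"
proof -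
  have "((\<lambda>x. (-1) ^ k * x ^ (2 * k + 1) / (2 ^ k * fact k * real (2 * k + 1)))
          has_real_derivative (- x\<^sup>2 / 2) ^ k / fact k) (at x)" for k
  proof -
    have "((\<lambda>x. (-1) ^ k * x ^ (2 * k + 1) / (2 ^ k * fact k * real (2 * k + 1)))
          has_real_derivative
            (-1) ^ k * (real (2 * k + 1) * x ^ (2 * k)) / (2 ^ k * fact k * real (2 * k + 1))) (at x)"
      using DERIV_pow[of "2 * k + 1" x] by (intro DERIV_cdivide DERIV_cmult) simp
    moreover have "(-1) ^ k * (real (2 * k + 1) * x ^ (2 * k)) / (2 ^ k * fact k * real (2 * k + 1))
        = (-1) ^ k * x ^ (2 * k) / (2 ^ k * fact k)"
      by (simp add: divide_simps)
    moreover have "\<dots> = (- x\<^sup>2 / 2) ^ k / fact k"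
      by (simp add: power_mult power_divide power_minus[of "x\<^sup>2 / 2"])
    ultimately show ?thesis by simp
  qed
  thus ?thesis
    unfolding gauss_taylor_def [abs_def] exp_taylor_def
    by (intro DERIV_sum)
qed

text \<open>The difference \<open>g\<close> of \<open>Phi\<close> and the scaled polynomial starts
  at 1/2 and is monotone, because its derivative is the scaled Taylor error of \<open>exp\<close>,
  which has constant sign.\<close>

lemma Phi_taylor_bounds:
  assumes "x \<ge> 0"
  shows "even n \<Longrightarrow> 1 / 2 + gauss_taylor n x / sqrt (2 * pi) \<le> Phi x"
    and "odd n \<Longrightarrow> Phi x \<le> 1 / 2 + gauss_taylor n x / sqrt (2 * pi)"
proof -
  define g where "g = (\<lambda>y. Phi y - gauss_taylor n y / sqrt (2 * pi))"
  have g: "(g has_real_derivative (exp (- y\<^sup>2 / 2) - exp_taylor n (- y\<^sup>2 / 2)) / sqrt (2 * pi)) (at y)" for y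
    unfolding g_def
    using DERIV_diff[OF Phi_has_real_derivative DERIV_cdivide[OF gauss_taylor_has_real_derivative]]
    by (simp add: std_normal_density_def diff_divide_distrib)
  have g0: "g 0 = 1 / 2"
    by (simp add: g_def gauss_taylor_def Phi_0)
  show "1 / 2 + gauss_taylor n x / sqrt (2 * pi) \<le> Phi x" if "even n"
  proof -
    have "(exp (- y\<^sup>2 / 2) - exp_taylor n (- y\<^sup>2 / 2)) / sqrt (2 * pi) \<ge> 0" for y
      using exp_taylor_bounds(1)[OF _ that, of "- y\<^sup>2 / 2"]
      by (intro divide_nonneg_nonneg) auto
    with g have "g 0 \<le> g x"
      using assms by (intro DERIV_nonneg_imp_nondecreasing[of 0 x g]) blast+
    thus ?thesis unfolding g0 by (simp add: g_def)
  qed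
  show "Phi x \<le> 1 / 2 + gauss_taylor n x / sqrt (2 * pi)" if "odd n"
  proof -
    have "(exp (- y\<^sup>2 / 2) - exp_taylor n (- y\<^sup>2 / 2)) / sqrt (2 * pi) \<le> 0" for y
      using exp_taylor_bounds(2)[OF _ that, of "- y\<^sup>2 / 2"]
      by (intro divide_nonpos_nonneg) auto
    with g have "g x \<le> g 0"
      using assms by (intro DERIV_nonpos_imp_nonincreasing[of 0 x g]) blast+
    thus ?thesis unfolding g0 by (simp add: g_def)
  qed
qed

section \<open>Numerical location of the threshold\<close>

lemma inverse_sqrt_2pi_bounds:
  "39894 / 100000 \<le> 1 / sqrt (2 * pi)" "1 / sqrt (2 * pi) \<le> 39895 / 100000"
proof -
  have "sqrt (2 * pi) \<le> 100000 / 39894"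
    by (rule real_le_lsqrt) (use pi_approx in \<open>auto simp: power2_eq_square\<close>)
  moreover have "100000 / 39895 \<le> sqrt (2 * pi)"
    by (rule real_le_rsqrt) (use pi_approx in \<open>auto simp: power2_eq_square\<close>)
  ultimately show "39894 / 100000 \<le> 1 / sqrt (2 * pi)" "1 / sqrt (2 * pi) \<le> 39895 / 100000"
    by (auto simp: field_simps)
qed

lemma x_c_bounds: "Phi x_c = 1 - F_G" "1.4073 < x_c" "x_c < 1.4083"
proof -
  define a b c :: real where "a = 1.4073" and "b = 1.4083" and "c = 1 / sqrt (2 * pi)"
  have c: "0.39894 \<le> c" "c \<le> 0.39895"
    using inverse_sqrt_2pi_bounds by (simp_all add: c_def)
  \<comment> \<open>Seven terms overestimate at \<open>a\<close> and eight underestimate at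
    \<open>b\<close>, as the two sides require. At \<open>a\<close> the first omitted term is below
    2/100000, well within the margin left by the window.\<close>
  have g: "gauss_taylor 7 a \<le> 1.05363" "1.05398 \<le> gauss_taylor 8 b"
    by (simp_all add: a_def b_def gauss_taylor_def eval_nat_numeral)
  have "Phi a \<le> 1 / 2 + gauss_taylor 7 a * c"
    using Phi_taylor_bounds(2)[of a 7] by (simp add: a_def c_def)
  also have "gauss_taylor 7 a * c \<le> 1.05363 * 0.39895"
    by (rule mult_mono[OF g(1) c(2)]) (use c in auto)
  also have "1 / 2 + 1.05363 * 0.39895 < 1 - F_G"
    by (simp add: F_G_def)
  finally have lower: "Phi a < 1 - F_G" by simp
  have "1 - F_G < 1 / 2 + 1.05398 * 0.39894"
    by (simp add: F_G_def)
  also have "1.05398 * 0.39894 \<le> gauss_taylor 8 b * c"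
    by (rule mult_mono[OF g(2) c(1)]) (use g(2) in auto)
  also have "1 / 2 + gauss_taylor 8 b * c \<le> Phi b"
    using Phi_taylor_bounds(1)[of b 8] by (simp add: b_def c_def)
  finally have upper: "1 - F_G < Phi b" by simp
  show "Phi x_c = 1 - F_G" "1.4073 < x_c" "x_c < 1.4083"
    unfolding x_c_def using inv_Phi_bounds[OF lower upper] by (simp_all add: a_def b_def)
qed

section \<open>The cluster and void fractions\<close>

text \<open>Integrability comes from the third and first normal moments. The value comes from the
  antiderivative \<open>F\<close> below, which vanishes at infinity.\<close>

lemma integral_std_normal_density_H3:
  "(LBINT t:{x..}. std_normal_density t * H3 t) = (x\<^sup>2 - 1) * std_normal_density x" (is ?int)
  "set_integrable lborel {x..} (\<lambda>t. std_normal_density t * H3 t)" (is ?ible)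
proof -
  have "integrable lborel (\<lambda>t. std_normal_density t * t ^ 3 - 3 * (std_normal_density t * t ^ 1))"
    by (intro Bochner_Integration.integrable_diff integrable_mult_right integrable_std_normal_moment)
  also have "(\<lambda>t. std_normal_density t * t ^ 3 - 3 * (std_normal_density t * t ^ 1)) =
      (\<lambda>t. std_normal_density t * H3 t)"
    by (auto simp: H3_def algebra_simps)
  finally have int: "set_integrable lborel S (\<lambda>t. std_normal_density t * H3 t)"
    if "S \<in> sets borel" for S
    unfolding set_integrable_def using that by (intro integrable_mult_indicator) auto
  show ?ible by (rule int) auto
  define F where "F = (\<lambda>t. (1 - t\<^sup>2) * std_normal_density t)"
  have F: "(F has_real_derivative std_normal_density t * H3 t) (at t)" for t
    unfolding F_def
    by (rule derivative_eq_intros std_normal_density_has_real_derivative refl)+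
       (simp add: H3_def algebra_simps power2_eq_square power3_eq_cube)
  have F_lim: "(F \<longlongrightarrow> 0) at_top"
    unfolding F_def std_normal_density_def by real_asymp
  \<comment> \<open>The endpoint is dropped because interval integrals up to infinity are taken over
    open intervals.\<close>
  have "(LBINT t:{x..}. std_normal_density t * H3 t) = (LBINT t:{x<..}. std_normal_density t * H3 t)"
    by (simp only: set_integral_greaterThan_eq_atLeast)
  also have "\<dots> = (LBINT t=ereal x..\<infinity>. std_normal_density t * H3 t)"
    by (simp add: interval_integral_to_infinity_eq)
  also have "\<dots> = 0 - F x"
  proof (rule interval_integral_FTC_integrable)
    show "((F \<circ> real_of_ereal) \<longlongrightarrow> F x) (at_right (ereal x))"
      unfolding ereal_tendsto_simps
      using DERIV_isCont[OF F, of x] by (simp add: isCont_def filterlim_at_split)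
    show "((F \<circ> real_of_ereal) \<longlongrightarrow> 0) (at_left \<infinity>)"
      unfolding ereal_tendsto_simps by (rule F_lim)
    show "set_integrable lborel (einterval (ereal x) \<infinity>) (\<lambda>t. std_normal_density t * H3 t)"
      by (rule int) auto
    show "isCont (\<lambda>t. std_normal_density t * H3 t) t" for t
      unfolding H3_def by (intro continuous_intros continuous_std_normal_density)
  qed (use F in \<open>auto simp: has_real_derivative_iff_has_vector_derivative\<close>)
  finally show ?int by (simp add: F_def algebra_simps)
qed

text \<open>The calibration \<open>Phi x_c = 1 - F_G\<close> fixes the constant term. There is no
  remainder in \<epsilon>, so all higher-order terms of the entropy difference stem from
  \<open>h\<close>.\<close>

lemma F_C_eq: "F_C \<epsilon> = F_G + A * \<epsilon>"
proof -
  have "F_C \<epsilon> = (LBINT t:{x_c..}. std_normal_density t + \<epsilon> / 6 * (std_normal_density t * H3 t))"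
    unfolding F_C_def edgeworth_density_def by (simp add: algebra_simps)
  also have "\<dots> = (LBINT t:{x_c..}. std_normal_density t) +
      \<epsilon> / 6 * (LBINT t:{x_c..}. std_normal_density t * H3 t)"
    by (subst set_integral_add)
       (auto intro!: set_integrable_std_normal_density set_integrable_mult_right
          integral_std_normal_density_H3(2))
  also have "\<dots> = F_G + A * \<epsilon>"
    by (simp add: integral_std_normal_density_atLeast integral_std_normal_density_H3 x_c_bounds(1) A_def)
  finally show ?thesis .
qed

text \<open>The density is even and \<open>H3\<close> is odd, so reflection only flips the sign of
  the amplitude.\<close>

lemma F_V_eq_F_C: "F_V \<epsilon> = F_C (- \<epsilon>)"
proof -
  have "edgeworth_density \<epsilon> (- t) = edgeworth_density (- \<epsilon>) t" for t
    by (simp add: edgeworth_density_def H3_def algebra_simps)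
  thus ?thesis
    by (simp add: F_V_def F_C_def set_integral_atMost_uminus)
qed

section \<open>Expansion of the entropy difference\<close>

lemma h_has_real_derivative:
  assumes "p > 0"
  shows "(h has_real_derivative - log 2 (exp 1 * p)) (at p)"
proof -
  have "((\<lambda>p. - p * (ln p / ln 2)) has_real_derivative - log 2 (exp 1 * p)) (at p)"
    using assms by (auto intro!: derivative_eq_intros simp: log_def ln_mult field_simps)
  thus ?thesis
    by (simp add: h_def [abs_def] log_def)
qed

text \<open>Scaling by \<open>t = c * x\<close> makes the logarithms of \<open>c\<close> cancel and
  reduces the remainder to the quadratic bound on \<open>ln (1 + x) - x\<close>.\<close>

lemma h_taylor_bigo:
  assumes "c > 0"
  shows "(\<lambda>t. h (c + t) - h c + log 2 (exp 1 * c) * t) \<in> O[nhds 0](\<lambda>t. t\<^sup>2)"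
proof (rule bigoI)
  \<comment> \<open>With \<open>x = t / c\<close>, the final estimate
    \<open>c * (4 * x\<^sup>2 + x\<^sup>2) / ln 2\<close> equals \<open>K * t\<^sup>2\<close>; the 4
    combines \<open>\<bar>1 + x\<bar> \<le> 2\<close> with the factor 2 of the logarithm
    bound.\<close>
  define K where "K = (4 / c + 1 / c) / ln 2"
  have "\<forall>\<^sub>F t in nhds 0. t \<in> {- c / 2<..<c / 2}"
    using assms by (intro eventually_nhds_in_open) auto
  thus "\<forall>\<^sub>F t in nhds 0. norm (h (c + t) - h c + log 2 (exp 1 * c) * t) \<le> K * norm (t\<^sup>2)"
  proof eventually_elim
    case (elim t)
    define x where "x = t / c"
    have t: "t = c * x" using assms by (simp add: x_def)
    have x: "\<bar>x\<bar> \<le> 1 / 2"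
      using elim assms by (auto simp: x_def abs_le_iff field_simps)
    have bound: "\<bar>ln (1 + x) - x\<bar> \<le> 2 * x\<^sup>2"
      using x by (rule abs_ln_one_plus_x_minus_x_bound)
    have ln: "ln (c + t) = ln c + ln (1 + x)"
    proof -
      have "c + t = c * (1 + x)" by (simp add: t algebra_simps)
      thus ?thesis using x assms by (simp add: ln_mult)
    qed
    have "h (c + t) - h c + log 2 (exp 1 * c) * t = - (c * ((1 + x) * (ln (1 + x) - x) + x\<^sup>2)) / ln 2"
      using assms unfolding h_def log_def ln by (simp add: t ln_mult field_simps power2_eq_square)
    also have "\<bar>\<dots>\<bar> \<le> c * (2 * (2 * x\<^sup>2) + x\<^sup>2) / ln 2"
    proof -
      have "\<bar>(1 + x) * (ln (1 + x) - x) + x\<^sup>2\<bar> \<le> \<bar>1 + x\<bar> * \<bar>ln (1 + x) - x\<bar> + x\<^sup>2"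
        by (metis abs_mult abs_power2 abs_triangle_ineq)
      also have "\<bar>1 + x\<bar> * \<bar>ln (1 + x) - x\<bar> \<le> 2 * (2 * x\<^sup>2)"
        by (rule mult_mono[OF _ bound]) (use x in auto)
      finally show ?thesis
        using assms by (auto simp: abs_mult intro!: divide_right_mono mult_left_mono)
    qed
    also have "\<dots> = K * norm (t\<^sup>2)"
      using assms by (simp add: K_def t field_simps power2_eq_square)
    finally show ?case by simp
  qed
qed

section \<open>Numerical enclosure of the leading coefficient\<close>

lemma ln_F_G_bounds: "-2.5308 \<le> ln F_G" "ln F_G \<le> -2.5307"
  and ln_2_bounds: "0.69314 \<le> ln (2 :: real)" "ln (2 :: real) \<le> 0.69315"
proof -
  show ln2: "0.69314 \<le> ln (2 :: real)" "ln (2 :: real) \<le> 0.69315"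
    using ln_approx_bounds[of 2 5] by (simp_all add: eval_nat_numeral)
  \<comment> \<open>Scaling by 16 moves the argument just above 1, where the logarithm approximation
    is accurate at low order.\<close>
  have "F_G = 1.2736 / 2 ^ 4"
    by (simp add: F_G_def)
  also have "ln (1.2736 / 2 ^ 4 :: real) = ln 1.2736 - ln (2 ^ 4)"
    by (rule ln_divide_pos) auto
  also have "ln (2 ^ 4 :: real) = 4 * ln 2"
    by (subst ln_realpow) auto
  finally have eq: "ln F_G = ln 1.2736 - 4 * ln 2" .
  define m :: real where "m = ln 1.2736"
  have "0.24184 \<le> m" "m \<le> 0.24186"
    unfolding m_def using ln_approx_bounds[of "1.2736" 3] by (simp_all add: eval_nat_numeral)
  thus "-2.5308 \<le> ln F_G" "ln F_G \<le> -2.5307"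
    unfolding eq m_def [symmetric] using ln2 by simp_all
qed

text \<open>On the window around \<open>x_c\<close> the factor \<open>x_c\<^sup>2 - 1\<close>
  increases and the exponential decreases. Each is bounded separately, at opposite ends of the
  window; the precision lost is affordable.\<close>

lemma amplitude_bounds: "0.14507 \<le> 6 * A" "6 * A \<le> 0.14574"
proof -
  have sq: "1.4073\<^sup>2 \<le> x_c\<^sup>2" "x_c\<^sup>2 \<le> 1.4083\<^sup>2"
    using x_c_bounds by (auto intro!: power_mono)
  have "exp (- x_c\<^sup>2 / 2) \<le> exp (- 1.4073\<^sup>2 / 2)"
    using sq by simp
  also have "\<dots> \<le> exp_taylor 9 (- 1.4073\<^sup>2 / 2)"
    by (rule exp_taylor_bounds) auto
  also have "\<dots> \<le> 0.3715"
    by (simp add: exp_taylor_def eval_nat_numeral)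
  finally have exp_upper: "exp (- x_c\<^sup>2 / 2) \<le> 0.3715" .
  have "0.37094 \<le> exp_taylor 8 (- 1.4083\<^sup>2 / 2)"
    by (simp add: exp_taylor_def eval_nat_numeral)
  also have "\<dots> \<le> exp (- 1.4083\<^sup>2 / 2)"
    by (rule exp_taylor_bounds) auto
  also have "\<dots> \<le> exp (- x_c\<^sup>2 / 2)"
    using sq by simp
  finally have exp_lower: "0.37094 \<le> exp (- x_c\<^sup>2 / 2)" .
  have A: "6 * A = (x_c\<^sup>2 - 1) * ((1 / sqrt (2 * pi)) * exp (- x_c\<^sup>2 / 2))"
    by (simp add: A_def std_normal_density_def)
  have "(x_c\<^sup>2 - 1) * ((1 / sqrt (2 * pi)) * exp (- x_c\<^sup>2 / 2))
      \<le> (1.4083\<^sup>2 - 1) * (39895 / 100000 * 0.3715)"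
    using sq exp_upper inverse_sqrt_2pi_bounds
    by (intro mult_mono) (auto simp: power2_eq_square)
  also have "(1.4083\<^sup>2 - 1) * (39895 / 100000 * 0.3715) \<le> (0.14574 :: real)"
    by (simp add: power2_eq_square)
  finally show "6 * A \<le> 0.14574" unfolding A .
  have "0.14507 \<le> (1.4073\<^sup>2 - 1) * (39894 / 100000 * 0.37094 :: real)"
    by (simp add: power2_eq_square)
  also have "\<dots> \<le> (x_c\<^sup>2 - 1) * ((1 / sqrt (2 * pi)) * exp (- x_c\<^sup>2 / 2))"
    using sq exp_lower inverse_sqrt_2pi_bounds
    by (intro mult_mono) (auto simp: power2_eq_square)
  finally show "0.14507 \<le> 6 * A" unfolding A .
qed

text \<open>Rewriting the slope as \<open>(- 1 - ln F_G) / ln 2\<close> leaves only the two enclosed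
  logarithms.\<close>

lemma slope_bounds: "2.2083 \<le> - log 2 (exp 1 * F_G)" "- log 2 (exp 1 * F_G) \<le> 2.2086"
proof -
  have "F_G > 0" by (simp add: F_G_def)
  hence eq: "- log 2 (exp 1 * F_G) = (- 1 - ln F_G) / ln 2"
    by (simp add: log_def ln_mult field_simps)
  have "2.2083 * ln 2 \<le> - 1 - ln F_G" "- 1 - ln F_G \<le> 2.2086 * ln 2"
    using ln_F_G_bounds ln_2_bounds by simp_all
  thus "2.2083 \<le> - log 2 (exp 1 * F_G)" "- log 2 (exp 1 * F_G) \<le> 2.2086"
    unfolding eq by (subst pos_le_divide_eq pos_divide_le_eq; simp)+
qed

theorem mainTheorem5:
  shows "(\<lambda>\<epsilon>. Delta_H_CV \<epsilon> - 2 * A * deriv h F_G * \<epsilon>) \<in> O[nhds 0](\<lambda>\<epsilon>. \<epsilon>\<^sup>2) \<and>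
    h field_differentiable at F_G \<and>
    deriv h F_G = - log 2 (exp 1 * F_G) \<and>
    - log 2 (exp 1 * F_G) > 0 \<and>
    \<bar>2 * A * deriv h F_G - 0.107\<bar> < 0.0005"
proof (intro conjI)
  define d where "d = - log 2 (exp 1 * F_G)"
  have F_G: "F_G > 0" by (simp add: F_G_def)
  have deriv: "(h has_real_derivative d) (at F_G)"
    unfolding d_def using F_G by (rule h_has_real_derivative)
  show "h field_differentiable at F_G"
    using deriv by (auto simp: field_differentiable_def)
  show *: "deriv h F_G = - log 2 (exp 1 * F_G)"
    using DERIV_imp_deriv[OF deriv] by (simp add: d_def)
  show "- log 2 (exp 1 * F_G) > 0"
    using slope_bounds by simp
  \<comment> \<open>\<open>2 * A * d\<close> is a third of \<open>6 * A * d\<close>, hence lies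
    roughly between 0.1068 and 0.1073.\<close>
  have "0.14507 * 2.2083 \<le> 6 * A * d" "6 * A * d \<le> 0.14574 * 2.2086"
    using amplitude_bounds slope_bounds unfolding d_def
    by (intro mult_mono; simp)+
  hence "0.1065 < 2 * A * d" "2 * A * d < 0.1075"
    by simp_all
  thus "\<bar>2 * A * deriv h F_G - 0.107\<bar> < 0.0005"
    unfolding * d_def [symmetric] by (simp add: abs_if)
  define r where "r = (\<lambda>t. h (F_G + t) - h F_G - d * t)"
  \<comment> \<open>Since \<open>nhds 0\<close> includes the point 0, the substitution is valid for
    every real \<open>c\<close>, zero included; it is used for \<open>A\<close> and
    \<open>- A\<close>.\<close>
  have r: "(\<lambda>\<epsilon>. r (c * \<epsilon>)) \<in> O[nhds 0](\<lambda>\<epsilon>. \<epsilon>\<^sup>2)" for c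
  proof -
    have "((\<lambda>\<epsilon>. c * \<epsilon>) \<longlongrightarrow> c * 0) (nhds 0)"
      by (intro tendsto_intros filterlim_ident)
    hence "(\<lambda>\<epsilon>. r (c * \<epsilon>)) \<in> O[nhds 0](\<lambda>\<epsilon>. (c * \<epsilon>)\<^sup>2)"
      using landau_o.big.compose[OF h_taylor_bigo[OF F_G], of "\<lambda>\<epsilon>. c * \<epsilon>" "nhds 0"]
      by (simp add: r_def d_def)
    also have "(\<lambda>\<epsilon>. (c * \<epsilon>)\<^sup>2) \<in> O[nhds 0](\<lambda>\<epsilon>. \<epsilon>\<^sup>2)"
      by (intro bigoI[of _ "c\<^sup>2"]) (simp add: power_mult_distrib)
    finally show ?thesis .
  qed
  have "(\<lambda>\<epsilon>. r (A * \<epsilon>) - r (- A * \<epsilon>)) \<in> O[nhds 0](\<lambda>\<epsilon>. \<epsilon>\<^sup>2)"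
    by (intro sum_in_bigo r)
  \<comment> \<open>In the difference the constants \<open>h F_G\<close> cancel, while the linear
    terms of opposite sign add up to the factor 2.\<close>
  moreover have "r (A * \<epsilon>) - r (- A * \<epsilon>) = Delta_H_CV \<epsilon> - 2 * A * deriv h F_G * \<epsilon>" for \<epsilon>
    unfolding * d_def [symmetric]
    by (simp add: r_def Delta_H_CV_def F_V_eq_F_C F_C_eq algebra_simps)
  ultimately show "(\<lambda>\<epsilon>. Delta_H_CV \<epsilon> - 2 * A * deriv h F_G * \<epsilon>) \<in> O[nhds 0](\<lambda>\<epsilon>. \<epsilon>\<^sup>2)"
    by simp
qed

end
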